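(* Let $((S,d),\phi)$ be a flow of $\mathcal L_{qm}$ and $k\in\mathbb N$. If either $\widetilde h(\phi^k)=0$ or $\mathcal I_\phi(S)=\mathcal I_{\phi^k}(S)$, then $\widetilde h(\phi^k)=k\cdot\widetilde h(\phi)$.
   Context: A generalized quasimetric on a non-empty set $S$ is a function $d\colon S\times S\to\mathbb R_{\ge0}\cup\{\infty\}$ with (QM1) $d(x,y)=d(y,x)=0$ if and only if $x=y$, and (QM2) $d(x,z)\le d(x,y)+d(y,z)$ for all $x,y,z$. It induces the partial order $x\le y\iff d(y,x)=0$. The category $\mathcal L_{qm}$ has as objects the pairs $(S,d)$ such that $d$ is a generalized quasimetric, $(S,\le)$ is a join-semilattice (join written $+$) with bottom element $0$, and (QM3) $d(x,y)=d(x,x+y)$ for all $x,y$; its morphisms are the maps $\phi\colon (S,d)\to(S',d')$ with $\phi(x+y)=\phi(x)+\phi(y)$, $\phi(0)=0$ and $d'(\phi(x),\phi(y))\le d(x,y)$ for all $x,y$. A flow of $\mathcal L_{qm}$ is a pair $((S,d),\phi)$ with $(S,d)\in\mathcal L_{qm}$ and $\phi\colon(S,d)\to(S,d)$ an endomorphism in $\mathcal L_{qm}$. For a flow $((S,d),\phi)$ of $\mathcal L_{qm}$, $x\in S$ is $\phi$-inert if $d(x,\phi(x))<\infty$; $\mathcal I_\phi(S)$ is the set of $\phi$-inert elements; $T_n(\phi,x)=x+\phi(x)+\dots+\phi^{n-1}(x)$ for $n\ge1$. For $x\in\mathcal I_\phi(S)$ put $\widetilde h(\phi,x)=\lim_{n\to\infty}\frac{d(x,T_n(\phi,x))}{n}$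 (this limit exists), and $\widetilde h(\phi)=\sup\{\widetilde h(\phi,x)\mid x\in\mathcal I_\phi(S)\}\in\mathbb R_{\ge0}\cup\{\infty\}$. $\mathbb N$ contains $0$; $\phi^0$ is the identity; $0\cdot\infty=0$. *)

theory Defs
  imports "HOL-Analysis.Analysis" "HOL-Algebra.Lattice"
begin

text \<open>Conditions are only imposed on the carrier set \<open>S\<close>; the values of \<open>d\<close> and of maps
  outside \<open>S\<close> are irrelevant.\<close>

locale generalized_quasimetric =
  fixes S :: "'a set" and d :: "'a \<Rightarrow> 'a \<Rightarrow> ennreal"
  assumes nonempty: "S \<noteq> {}"
    and qm1: "\<lbrakk>x \<in> S; y \<in> S\<rbrakk> \<Longrightarrow> (d x y = 0 \<and> d y x = 0) \<longleftrightarrow> x = y"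
    and qm2: "\<lbrakk>x \<in> S; y \<in> S; z \<in> S\<rbrakk> \<Longrightarrow> d x z \<le> d x y + d y z"

text \<open>Note the swap of the arguments: \<open>x \<le> y\<close> iff \<open>d y x = 0\<close>.\<close>

definition qm_order :: "'a set \<Rightarrow> ('a \<Rightarrow> 'a \<Rightarrow> ennreal) \<Rightarrow> 'a gorder" where
  "qm_order S d = \<lparr>carrier = S, eq = (=), le = (\<lambda>x y. d y x = 0)\<rparr>"

text \<open>The semilattice structure of an object is determined by \<open>d\<close>: the sum and \<open>0\<close> are the join
  and the bottom element of the induced order.\<close>

abbreviation qm_add :: "'a set \<Rightarrow> ('a \<Rightarrow> 'a \<Rightarrow> ennreal) \<Rightarrow> 'a \<Rightarrow> 'a \<Rightarrow> 'a" where
  "qm_add S d x y \<equiv> x \<squnion>\<^bsub>qm_order S d\<^esub> y"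

abbreviation qm_zero :: "'a set \<Rightarrow> ('a \<Rightarrow> 'a \<Rightarrow> ennreal) \<Rightarrow> 'a" where
  "qm_zero S d \<equiv> \<bottom>\<^bsub>qm_order S d\<^esub>"

locale Lqm = generalized_quasimetric S d
    + upper_semilattice "qm_order S d"
    + weak_partial_order_bottom "qm_order S d"
  for S :: "'a set" and d :: "'a \<Rightarrow> 'a \<Rightarrow> ennreal" +
  assumes qm3: "\<lbrakk>x \<in> S; y \<in> S\<rbrakk> \<Longrightarrow> d x y = d x (qm_add S d x y)"

definition Lqm_hom ::
  "'a set \<Rightarrow> ('a \<Rightarrow> 'a \<Rightarrow> ennreal) \<Rightarrow> 'b set \<Rightarrow> ('b \<Rightarrow> 'b \<Rightarrow> ennreal) \<Rightarrow> ('a \<Rightarrow> 'b) \<Rightarrow> bool" where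
  "Lqm_hom S d S' d' \<phi> \<longleftrightarrow>
     \<phi> \<in> S \<rightarrow> S' \<and>
     (\<forall>x\<in>S. \<forall>y\<in>S. \<phi> (qm_add S d x y) = qm_add S' d' (\<phi> x) (\<phi> y)) \<and>
     \<phi> (qm_zero S d) = qm_zero S' d' \<and>
     (\<forall>x\<in>S. \<forall>y\<in>S. d' (\<phi> x) (\<phi> y) \<le> d x y)"

definition Lqm_flow :: "'a set \<Rightarrow> ('a \<Rightarrow> 'a \<Rightarrow> ennreal) \<Rightarrow> ('a \<Rightarrow> 'a) \<Rightarrow> bool" where
  "Lqm_flow S d \<phi> \<longleftrightarrow> Lqm S d \<and> Lqm_hom S d S d \<phi>"

definition inert :: "'a set \<Rightarrow> ('a \<Rightarrow> 'a \<Rightarrow> ennreal) \<Rightarrow> ('a \<Rightarrow> 'a) \<Rightarrow> 'a set" where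
  "inert S d \<phi> = {x \<in> S. d x (\<phi> x) < \<infinity>}"

text \<open>\<open>trajectory S d \<phi> x n\<close> is \<open>x + \<phi> x + \<dots> + \<phi>\<^sup>n\<^sup>-\<^sup>1 x\<close>. The value \<open>0\<close> at \<open>n = 0\<close> is the empty sum;
  it plays no role in the limit below.\<close>

primrec trajectory ::
  "'a set \<Rightarrow> ('a \<Rightarrow> 'a \<Rightarrow> ennreal) \<Rightarrow> ('a \<Rightarrow> 'a) \<Rightarrow> 'a \<Rightarrow> nat \<Rightarrow> 'a" where
  "trajectory S d \<phi> x 0 = qm_zero S d"
| "trajectory S d \<phi> x (Suc n) = qm_add S d (trajectory S d \<phi> x n) ((\<phi> ^^ n) x)"

definition entropy_at :: "'a set \<Rightarrow> ('a \<Rightarrow> 'a \<Rightarrow> ennreal) \<Rightarrow> ('a \<Rightarrow> 'a) \<Rightarrow> 'a \<Rightarrow> ennreal" where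
  "entropy_at S d \<phi> x = lim (\<lambda>n. d x (trajectory S d \<phi> x n) / of_nat n)"

definition entropy :: "'a set \<Rightarrow> ('a \<Rightarrow> 'a \<Rightarrow> ennreal) \<Rightarrow> ('a \<Rightarrow> 'a) \<Rightarrow> ennreal" where
  "entropy S d \<phi> = (SUP x\<in>inert S d \<phi>. entropy_at S d \<phi> x)"

end

theory Submission
  imports Defs
begin

text \<open>
  Write \<open>T\<^sub>n x = x + \<phi> x + \<dots> + \<phi>\<^sup>n\<^sup>-\<^sup>1 x\<close>. The distance \<open>d\<close> is antitone in its first argument and
  monotone in its second, and every estimate below comes from this, the triangle inequality and
  the fact that \<open>\<phi>\<close> is an additive contraction.

  \<^emph>\<open>The limit exists.\<close> Since \<open>T\<^sub>m\<^sub>+\<^sub>n x = T\<^sub>m x + \<phi>\<^sup>m (T\<^sub>n x)\<close> and \<open>\<phi>\<^sup>m\<^sup>-\<^sup>1 x \<le> T\<^sub>m x\<close>, axiom (QM3) bounds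
  \<open>d (T\<^sub>m x) (T\<^sub>m\<^sub>+\<^sub>n x)\<close> by \<open>d x (\<phi> (T\<^sub>n x))\<close>, hence by \<open>d x (T\<^sub>n\<^sub>+\<^sub>1 x)\<close>. So the sequence
  \<open>n \<mapsto> d x (T\<^sub>n\<^sub>+\<^sub>1 x)\<close> is subadditive (\<open>traj_dist_subadditive\<close>); for inert \<open>x\<close> it is finite, and
  Fekete's lemma applies (\<open>entropy_at_limit\<close>).

  \<^emph>\<open>Lower bound, for every flow.\<close> The trajectory of \<open>T\<^sub>k x\<close> under \<open>\<phi>\<^sup>k\<close> is exactly
  \<open>n \<mapsto> T\<^sub>k\<^sub>n x\<close>, and moving the base point from \<open>x\<close> to \<open>T\<^sub>k x\<close> costs a constant that vanishes after
  division by \<open>n\<close>. Hence \<open>k\<close> times the entropy of \<open>\<phi>\<close> at an inert \<open>x\<close> is at most the entropy of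
  \<open>\<phi>\<^sup>k\<close> at \<open>T\<^sub>k x\<close>, which is inert for \<open>\<phi>\<^sup>k\<close>; this is \<open>entropy_power_ge\<close>. It settles the
  case in which \<open>\<phi>\<^sup>k\<close> has entropy \<open>0\<close>.

  \<^emph>\<open>Upper bound.\<close> For \<open>k > 0\<close>, the \<open>n\<close>-th trajectory of \<open>x\<close> under \<open>\<phi>\<^sup>k\<close> lies below \<open>T\<^sub>k\<^sub>n x\<close>, which
  bounds the entropy of \<open>\<phi>\<^sup>k\<close> at \<open>x\<close> by \<open>k\<close> times that of \<open>\<phi>\<close>, but only at points \<open>x\<close> that are
  inert for \<open>\<phi>\<close> as well. When the inert points of \<open>\<phi>\<close> and \<open>\<phi>\<^sup>k\<close> agree, all points entering
  the supremum are of this kind (\<open>entropy_power_le\<close>). For \<open>k = 0\<close> both sides are \<open>0\<close>.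
\<close>

section \<open>Fekete's lemma\<close>

lemma subadditive_multiple:
  fixes u :: "nat \<Rightarrow> ennreal"
  assumes "\<And>m n. u (m + n) \<le> u m + u n"
  shows "u (q * p + r) \<le> of_nat q * u p + u r"
proof (induction q)
  case (Suc q)
  have "u (Suc q * p + r) \<le> u p + u (q * p + r)"
    using assms[of p "q * p + r"] by (simp add: add.assoc)
  also have "\<dots> \<le> u p + (of_nat q * u p + u r)"
    by (intro add_left_mono Suc)
  finally show ?case
    by (simp add: algebra_simps)
qed simp

text \<open>
  The infimum is a lower bound at every index. Conversely, once \<open>u p / p\<close> is close to the infimum,
  division of \<open>n\<close> by \<open>p\<close> with remainder gives \<open>u n / n \<le> u p / p + M / n\<close>, where \<open>M\<close> bounds the
  finitely many values of \<open>u\<close> at the possible remainders.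
\<close>

lemma fekete:
  fixes u :: "nat \<Rightarrow> ennreal"
  assumes subadd: "\<And>m n. u (m + n) \<le> u m + u n"
    and fin: "\<And>n. u n < \<infinity>"
  shows "(\<lambda>n. u n / of_nat n) \<longlonglongrightarrow> (INF n\<in>{1..}. u n / of_nat n)" (is "_ \<longlonglongrightarrow> ?L")
proof (rule order_tendstoI)
  fix a assume "a < ?L"
  then have "a < u n / of_nat n" if "n \<ge> 1" for n
    using that by (auto intro: less_le_trans INF_lower)
  then show "eventually (\<lambda>n. a < u n / of_nat n) sequentially"
    by (auto simp: eventually_sequentially)
next
  fix a assume "?L < a"
  then obtain p where p: "p \<ge> 1" "u p / of_nat p < a"
    by (auto simp: INF_less_iff)
  define M where "M = (\<Sum>r<p. u r)"
  have "M < \<infinity>"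
    unfolding M_def using fin by (simp add: ennreal_sum_less_top less_top)
  then obtain m where m: "M = ennreal m" "m \<ge> 0"
    by (cases M) auto
  obtain v where v: "u p = ennreal v" "v \<ge> 0"
    using fin[of p] by (cases "u p") auto
  have bound: "u n / of_nat n \<le> ennreal (v / p + m / n)" if n: "n \<ge> 1" for n
  proof -
    have "u n \<le> of_nat (n div p) * u p + u (n mod p)"
      using subadditive_multiple[of u "n div p" p "n mod p", OF subadd] by simp
    also have "\<dots> \<le> of_nat (n div p) * u p + M"
      unfolding M_def using p(1) by (intro add_left_mono member_le_sum) auto
    also have "\<dots> = ennreal (real (n div p) * v + m)"
      using v m by (simp add: ennreal_of_nat_eq_real_of_nat ennreal_mult'')
    finally have "u n / of_nat n \<le> ennreal (real (n div p) * v + m) / of_nat n"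
      by (rule divide_right_mono_ennreal)
    also have "\<dots> = ennreal ((real (n div p) * v + m) / n)"
      using n v m by (simp add: ennreal_of_nat_eq_real_of_nat divide_ennreal del: ennreal_plus)
    also have "\<dots> \<le> ennreal (v / p + m / n)"
    proof (rule ennreal_leI)
      have "real (n div p) \<le> real n / real p"
        by (rule of_nat_div_le_of_nat)
      then have "real (n div p) * v \<le> real n / real p * v"
        using v(2) by (rule mult_right_mono)
      then show "(real (n div p) * v + m) / n \<le> v / p + m / n"
        using n by (simp add: add_divide_distrib pos_divide_le_eq mult.commute)
    qed
    finally show ?thesis .
  qed
  have "(\<lambda>n. ennreal (v / p + m / real n)) \<longlonglongrightarrow> ennreal (v / p + 0)"
    by (intro tendsto_ennrealI tendsto_intros lim_const_over_n)
  moreover have "ennreal (v / p + 0) < a"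
    using p v by (simp add: ennreal_of_nat_eq_real_of_nat divide_ennreal)
  ultimately have "eventually (\<lambda>n. ennreal (v / p + m / real n) < a) sequentially"
    by (rule order_tendstoD(2))
  then show "eventually (\<lambda>n. u n / of_nat n < a) sequentially"
    using eventually_ge_at_top[of 1] by eventually_elim (meson bound le_less_trans)
qed

text \<open>
  Distances along trajectories are subadditive only after an index shift; the shift is absorbed
  by the factor \<open>n / (n + 1)\<close>, which tends to \<open>1\<close>.
\<close>

lemma fekete_shifted:
  fixes a :: "nat \<Rightarrow> ennreal"
  assumes "\<And>m n. a (Suc (m + n)) \<le> a (Suc m) + a (Suc n)"
    and "\<And>n. a (Suc n) < \<infinity>"
  shows "convergent (\<lambda>n. a n / of_nat n)"
proof -
  define L where "L = (INF n\<in>{1..}. a (Suc n) / of_nat n)"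
  have "(\<lambda>n. a (Suc n) / of_nat n) \<longlonglongrightarrow> L"
    unfolding L_def using fekete[of "\<lambda>n. a (Suc n)"] assms by simp
  moreover have "(\<lambda>n. ennreal (real n / real (Suc n))) \<longlonglongrightarrow> ennreal 1"
    by (intro tendsto_ennrealI LIMSEQ_n_over_Suc_n)
  ultimately have "(\<lambda>n. a (Suc n) / of_nat n * ennreal (real n / real (Suc n))) \<longlonglongrightarrow> L * ennreal 1"
    by (intro tendsto_mult_ennreal) auto
  moreover have "a (Suc n) / of_nat n * ennreal (real n / real (Suc n)) = a (Suc n) / of_nat (Suc n)"
    if n: "n \<ge> 1" for n
  proof -
    obtain r where r: "a (Suc n) = ennreal r" "r \<ge> 0"
      using assms(2)[of n] by (cases "a (Suc n)") auto
    show ?thesis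
      using n r
      by (simp add: ennreal_of_nat_eq_real_of_nat divide_ennreal flip: ennreal_mult del: of_nat_Suc)
  qed
  then have "eventually (\<lambda>n. a (Suc n) / of_nat n * ennreal (real n / real (Suc n))
      = a (Suc n) / of_nat (Suc n)) sequentially"
    by (auto simp: eventually_sequentially)
  ultimately have "(\<lambda>n. a (Suc n) / of_nat (Suc n)) \<longlonglongrightarrow> L * ennreal 1"
    by (rule Lim_transform_eventually)
  then have "(\<lambda>n. a n / of_nat n) \<longlonglongrightarrow> L * ennreal 1"
    by (rule LIMSEQ_imp_Suc)
  then show ?thesis
    by (rule convergentI)
qed

section \<open>The order of a quasimetric semilattice\<close>

context Lqm
begin

lemma qm_carrier [simp]: "carrier (qm_order S d) = S"
  by (simp add: qm_order_def)

lemma qm_le_iff: "le (qm_order S d) x y \<longleftrightarrow> d y x = 0"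
  by (simp add: qm_order_def)

lemma dist_self: "x \<in> S \<Longrightarrow> d x x = 0"
  using qm1[of x x] by simp

lemma add_closed: "x \<in> S \<Longrightarrow> y \<in> S \<Longrightarrow> qm_add S d x y \<in> S"
  using join_closed[of x y] by simp

lemma zero_closed: "qm_zero S d \<in> S"
  using bottom_closed by simp

lemma dist_add_left: "x \<in> S \<Longrightarrow> y \<in> S \<Longrightarrow> d (qm_add S d x y) x = 0"
  using join_left[of x y] by (simp add: qm_le_iff)

lemma dist_add_right: "x \<in> S \<Longrightarrow> y \<in> S \<Longrightarrow> d (qm_add S d x y) y = 0"
  using join_right[of x y] by (simp add: qm_le_iff)

lemma dist_add_eq_0:
  "d z x = 0 \<Longrightarrow> d z y = 0 \<Longrightarrow> x \<in> S \<Longrightarrow> y \<in> S \<Longrightarrow> z \<in> S \<Longrightarrow> d z (qm_add S d x y) = 0"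
  using join_le[of x z y] by (simp add: qm_le_iff)

lemma dist_zero: "x \<in> S \<Longrightarrow> d x (qm_zero S d) = 0"
  using bottom_lower[of x] by (simp add: qm_le_iff)

text \<open>
  Here \<open>d y' y = 0\<close> says that \<open>y\<close> lies below \<open>y'\<close> in the induced order.
\<close>

lemma dist_antimono_left:
  assumes "d y' y = 0" "y \<in> S" "y' \<in> S" "z \<in> S"
  shows "d y' z \<le> d y z"
  using qm2[of y' y z] assms by simp

lemma dist_mono_right:
  assumes "d y' y = 0" "y \<in> S" "y' \<in> S" "z \<in> S"
  shows "d z y \<le> d z y'"
  using qm2[of z y' y] assms by simp

lemma add_zero_right: "x \<in> S \<Longrightarrow> qm_add S d x (qm_zero S d) = x"
  using qm1[of "qm_add S d x (qm_zero S d)" x]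
  by (simp add: add_closed zero_closed dist_add_left dist_add_eq_0 dist_self dist_zero)

lemma add_zero_left: "x \<in> S \<Longrightarrow> qm_add S d (qm_zero S d) x = x"
  by (simp add: join_comm[of _ "qm_zero S d"] add_zero_right)

lemma add_assoc:
  "x \<in> S \<Longrightarrow> y \<in> S \<Longrightarrow> z \<in> S \<Longrightarrow>
    qm_add S d (qm_add S d x y) z = qm_add S d x (qm_add S d y z)"
  using weak_join_assoc[of x y z] by (simp add: qm_order_def)

text \<open>Joins are idempotent, so the identity never leaves the down-set of its starting point.\<close>

lemma entropy_id: "entropy S d id = 0"
proof -
  have "entropy_at S d id x = 0" if x: "x \<in> S" for x
  proof -
    have "(id ^^ n) x = x" for n
      by (induction n) simp_all
    then have "trajectory S d id x n \<in> S \<and> d x (trajectory S d id x n) = 0" for n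
      by (induction n)
        (use x in \<open>simp_all add: zero_closed dist_zero add_closed dist_add_eq_0 dist_self del: id_funpow\<close>)
    then show ?thesis
      by (simp add: entropy_at_def lim_const)
  qed
  then show ?thesis
    by (auto simp: entropy_def inert_def bot_ennreal intro!: SUP_eqI antisym SUP_least)
qed

end

section \<open>Trajectories\<close>

locale quasimetric_flow = Lqm S d for S :: "'a set" and d :: "'a \<Rightarrow> 'a \<Rightarrow> ennreal" +
  fixes \<phi> :: "'a \<Rightarrow> 'a"
  assumes hom: "Lqm_hom S d S d \<phi>"
begin

abbreviation T :: "'a \<Rightarrow> nat \<Rightarrow> 'a" where
  "T \<equiv> trajectory S d \<phi>"

lemma power_hom: "Lqm_hom S d S d (\<phi> ^^ n)"
proof (induction n)
  case 0
  show ?case by (simp add: Lqm_hom_def)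
next
  case (Suc n)
  note f = hom[unfolded Lqm_hom_def] and g = Suc[unfolded Lqm_hom_def]
  have c: "(\<phi> ^^ n) x \<in> S" if "x \<in> S" for x
    using g that by (auto simp: Pi_iff)
  have "d (\<phi> ((\<phi> ^^ n) x)) (\<phi> ((\<phi> ^^ n) y)) \<le> d x y" if "x \<in> S" "y \<in> S" for x y
  proof -
    have "d (\<phi> ((\<phi> ^^ n) x)) (\<phi> ((\<phi> ^^ n) y)) \<le> d ((\<phi> ^^ n) x) ((\<phi> ^^ n) y)"
      using f c that by blast
    also have "\<dots> \<le> d x y"
      using g that by blast
    finally show ?thesis .
  qed
  then show ?case
    using f g c by (auto simp: Lqm_hom_def Pi_iff)
qed

lemma power_closed: "x \<in> S \<Longrightarrow> (\<phi> ^^ n) x \<in> S"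
  using power_hom[of n] by (auto simp: Lqm_hom_def Pi_iff)

lemma power_dist: "x \<in> S \<Longrightarrow> y \<in> S \<Longrightarrow> d ((\<phi> ^^ n) x) ((\<phi> ^^ n) y) \<le> d x y"
  using power_hom[of n] by (auto simp: Lqm_hom_def)

lemma power_add: "x \<in> S \<Longrightarrow> y \<in> S \<Longrightarrow>
    (\<phi> ^^ n) (qm_add S d x y) = qm_add S d ((\<phi> ^^ n) x) ((\<phi> ^^ n) y)"
  using power_hom[of n] by (auto simp: Lqm_hom_def)

lemma power_zero: "(\<phi> ^^ n) (qm_zero S d) = qm_zero S d"
  using power_hom[of n] by (auto simp: Lqm_hom_def)

lemma flow_power: "quasimetric_flow S d (\<phi> ^^ k)"
  by (intro quasimetric_flow.intro quasimetric_flow_axioms.intro power_hom) (rule Lqm_axioms)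

lemma traj_closed: "x \<in> S \<Longrightarrow> T x n \<in> S"
  by (induction n) (simp_all add: zero_closed add_closed power_closed)

lemma traj_add:
  assumes "x \<in> S"
  shows "T x (n + m) = qm_add S d (T x n) ((\<phi> ^^ n) (T x m))"
proof (induction m)
  case 0
  show ?case using assms by (simp add: power_zero add_zero_right traj_closed)
next
  case (Suc m)
  have "(\<phi> ^^ (n + m)) x = (\<phi> ^^ n) ((\<phi> ^^ m) x)"
    by (simp add: funpow_add)
  then show ?case
    using assms Suc
    by (simp add: power_add add_assoc traj_closed power_closed)
qed

lemma traj_mono:
  assumes "x \<in> S" "m \<le> n"
  shows "d (T x n) (T x m) = 0"
  using traj_add[OF assms(1), of m "n - m"] assms
  by (simp add: dist_add_left traj_closed power_closed)

lemma traj_ge_power: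
  assumes "x \<in> S" "i < n"
  shows "d (T x n) ((\<phi> ^^ i) x) = 0"
proof -
  have "d (T x n) ((\<phi> ^^ i) x) \<le> d (T x n) (T x (Suc i)) + d (T x (Suc i)) ((\<phi> ^^ i) x)"
    using assms by (intro qm2 traj_closed power_closed)
  also have "d (T x n) (T x (Suc i)) = 0"
    using assms by (intro traj_mono) auto
  also have "d (T x (Suc i)) ((\<phi> ^^ i) x) = 0"
    using assms by (simp add: dist_add_right traj_closed power_closed)
  finally show ?thesis by simp
qed

text \<open>
  Axiom (QM3) discards the part \<open>T\<^sub>m\<^sub>+\<^sub>1 x\<close> of the longer trajectory, the base point is lowered from
  \<open>T\<^sub>m\<^sub>+\<^sub>1 x\<close> to its summand \<open>\<phi>\<^sup>m x\<close>, and then the common factor \<open>\<phi>\<^sup>m\<close> is removed by contraction.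
  What is left is \<open>d x (\<phi> (T\<^sub>n x))\<close>; the extra \<open>\<phi>\<close> is why the last term is at \<open>n + 1\<close> and not at \<open>n\<close>.
\<close>

lemma traj_dist_subadditive:
  assumes x: "x \<in> S"
  shows "d x (T x (Suc (m + n))) \<le> d x (T x (Suc m)) + d x (T x (Suc n))"
proof -
  note closed = x traj_closed[OF x] power_closed add_closed
  let ?z = "(\<phi> ^^ 1) (T x n)"
  have "d (T x (Suc m)) (T x (Suc m + n)) = d (T x (Suc m)) ((\<phi> ^^ Suc m) (T x n))"
    unfolding traj_add[OF x] by (rule qm3[symmetric]; intro closed)
  also have "\<dots> \<le> d ((\<phi> ^^ m) x) ((\<phi> ^^ Suc m) (T x n))"
    by (rule dist_antimono_left[OF traj_ge_power[OF x]]; (intro closed)?) simp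
  also have "(\<phi> ^^ Suc m) (T x n) = (\<phi> ^^ m) ?z"
    by (simp add: funpow_swap1)
  also have "d ((\<phi> ^^ m) x) \<dots> \<le> d x ?z"
    by (rule power_dist; intro closed)
  also have "\<dots> \<le> d x (T x (1 + n))"
    unfolding traj_add[OF x]
    by (rule dist_mono_right[OF dist_add_right]; intro closed)
  finally have "d (T x (Suc m)) (T x (Suc m + n)) \<le> d x (T x (Suc n))"
    by simp
  moreover have "d x (T x (Suc m + n)) \<le> d x (T x (Suc m)) + d (T x (Suc m)) (T x (Suc m + n))"
    by (intro qm2 closed)
  ultimately show ?thesis
    unfolding add_Suc by (meson add_left_mono order_trans)
qed

text \<open>
  By (QM3), inertness says that the case \<open>n = 1\<close> is finite; subadditivity propagates this to all \<open>n\<close>.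
\<close>

lemma inert_traj_dist_finite:
  assumes "x \<in> inert S d \<phi>"
  shows "d x (T x (Suc n)) < \<infinity>"
proof (induction n)
  case 0
  show ?case using assms by (simp add: inert_def add_zero_left dist_self)
next
  case (Suc n)
  have x: "x \<in> S" "\<phi> x \<in> S" using assms power_closed[of x 1] by (auto simp: inert_def)
  have "d x (T x (Suc 1)) = d x (\<phi> x)"
    using x qm3[of x "\<phi> x"] by (simp add: add_zero_left)
  then have "d x (T x (Suc 1)) < \<infinity>"
    using assms by (simp add: inert_def)
  moreover have "d x (T x (Suc (Suc n))) \<le> d x (T x (Suc 1)) + d x (T x (Suc n))"
    using traj_dist_subadditive[OF x(1), of 1 n] by simp
  ultimately show ?case
    using Suc by (metis ennreal_add_less_top infinity_ennreal_def le_less_trans)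
qed

lemma entropy_at_limit:
  assumes "x \<in> inert S d \<phi>"
  shows "(\<lambda>n. d x (T x n) / of_nat n) \<longlonglongrightarrow> entropy_at S d \<phi> x"
proof -
  have "convergent (\<lambda>n. d x (T x n) / of_nat n)"
    using assms
    by (intro fekete_shifted inert_traj_dist_finite traj_dist_subadditive) (auto simp: inert_def)
  then show ?thesis
    unfolding entropy_at_def convergent_LIMSEQ_iff .
qed

section \<open>Iterating the flow\<close>

lemma traj_power_traj:
  assumes "x \<in> S"
  shows "trajectory S d (\<phi> ^^ k) (T x k) n = T x (k * n)"
proof (induction n)
  case (Suc n)
  then have "trajectory S d (\<phi> ^^ k) (T x k) (Suc n) = T x (k * n + k)"
    using traj_add[OF assms, of "k * n" k] by (simp add: funpow_mult)
  then show ?case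
    by (simp add: add.commute)
qed simp

text \<open>
  The powers of \<open>\<phi>\<close> that make up the trajectory under \<open>\<phi>\<^sup>k\<close> are those with exponents \<open>0, k, \<dots>, k (n - 1)\<close>,
  and for \<open>k > 0\<close> all of them are less than \<open>k n\<close>.
\<close>

lemma traj_power_le:
  assumes "x \<in> S" "k > 0"
  shows "d (T x (k * n)) (trajectory S d (\<phi> ^^ k) x n) = 0"
proof (induction n)
  case 0
  show ?case by (simp add: dist_zero zero_closed)
next
  case (Suc n)
  interpret power: quasimetric_flow S d "\<phi> ^^ k" by (rule flow_power)
  have "d (T x (k * Suc n)) (T x (k * n)) = 0"
    using assms by (intro traj_mono) auto
  then have "d (T x (k * Suc n)) (power.T x n) = 0"
    using dist_mono_right[OF Suc, of "T x (k * Suc n)"] assms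
    by (simp add: traj_closed power.traj_closed)
  moreover have "d (T x (k * Suc n)) ((\<phi> ^^ (k * n)) x) = 0"
    using assms by (intro traj_ge_power) auto
  ultimately show ?case
    using assms
    by (simp add: funpow_mult dist_add_eq_0 traj_closed power.traj_closed power_closed del: mult_Suc_right)
qed

text \<open>
  One step of \<open>\<phi>\<^sup>k\<close> from \<open>T\<^sub>k x\<close> costs \<open>d (T\<^sub>k x) (T\<^sub>2\<^sub>k x)\<close>, and \<open>x\<close> lies below \<open>T\<^sub>k x\<close>.
\<close>

lemma traj_inert_power:
  assumes "x \<in> inert S d \<phi>" "k > 0"
  shows "T x k \<in> inert S d (\<phi> ^^ k)"
proof -
  have x: "x \<in> S" using assms by (simp add: inert_def)
  note closed = x traj_closed[OF x] power_closed
  have "d (T x k) ((\<phi> ^^ k) (T x k)) = d (T x k) (T x (k + k))"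
    unfolding traj_add[OF x] by (rule qm3; intro closed)
  also have "\<dots> \<le> d x (T x (k + k))"
    \<comment> \<open>the summand of \<open>T x k\<close> with exponent \<open>0\<close> is \<open>x\<close>\<close>
    using traj_ge_power[OF x assms(2)] by (intro dist_antimono_left closed) simp
  also have "\<dots> < \<infinity>"
    using inert_traj_dist_finite[OF assms(1), of "k + k - 1"] assms(2) by simp
  finally show ?thesis
    using traj_closed[OF x] by (simp add: inert_def)
qed

lemma entropy_at_limit_multiples:
  assumes "x \<in> inert S d \<phi>" "k > 0"
  shows "(\<lambda>n. d x (T x (k * n)) / of_nat n) \<longlonglongrightarrow> of_nat k * entropy_at S d \<phi> x"
proof -
  have "strict_mono (\<lambda>n. k * n)"
    using assms(2) by (simp add: strict_mono_def)
  from LIMSEQ_subseq_LIMSEQ[OF entropy_at_limit[OF assms(1)] this]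
  have "(\<lambda>n. d x (T x (k * n)) / of_nat (k * n)) \<longlonglongrightarrow> entropy_at S d \<phi> x"
    by (simp add: o_def)
  then have "(\<lambda>n. of_nat k * (d x (T x (k * n)) / of_nat (k * n)))
      \<longlonglongrightarrow> of_nat k * entropy_at S d \<phi> x"
    by (intro ennreal_tendsto_cmult) (simp_all add: of_nat_less_top)
  moreover have "eventually (\<lambda>n. of_nat k * (d x (T x (k * n)) / of_nat (k * n))
      = d x (T x (k * n)) / of_nat n) sequentially"
    using eventually_gt_at_top[of 0]
  proof eventually_elim
    case (elim n)
    have "d x (T x (k * n)) < \<infinity>"
      using inert_traj_dist_finite[OF assms(1), of "k * n - 1"] elim assms(2) by simp
    then obtain r where "d x (T x (k * n)) = ennreal r" "r \<ge> 0"
      by (cases "d x (T x (k * n))") auto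
    then show ?case
      using elim assms(2)
      by (simp add: ennreal_of_nat_eq_real_of_nat divide_ennreal flip: ennreal_mult)
  qed
  ultimately show ?thesis
    by (rule Lim_transform_eventually)
qed

text \<open>
  The triangle inequality through \<open>T\<^sub>k x\<close> compares the two sequences up to the constant \<open>d x (T\<^sub>k x)\<close>.
  That constant is finite by inertness of \<open>x\<close>, so it disappears in the limit.
\<close>

lemma entropy_at_le_traj:
  assumes "x \<in> inert S d \<phi>" "k > 0"
  shows "of_nat k * entropy_at S d \<phi> x \<le> entropy_at S d (\<phi> ^^ k) (T x k)"
proof -
  interpret power: quasimetric_flow S d "\<phi> ^^ k" by (rule flow_power)
  have x: "x \<in> S" using assms by (simp add: inert_def)
  note closed = x traj_closed[OF x]
  let ?c = "d x (T x k)"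
  have "?c < \<infinity>"
    using inert_traj_dist_finite[OF assms(1), of "k - 1"] assms(2) by simp
  then obtain r where r: "?c = ennreal r" "r \<ge> 0"
    by (cases ?c) auto
  have "(\<lambda>n. ennreal (r / real n)) \<longlonglongrightarrow> ennreal 0"
    by (intro tendsto_ennrealI lim_const_over_n)
  moreover have "eventually (\<lambda>n. ennreal (r / real n) = ?c / of_nat n) sequentially"
    using eventually_gt_at_top[of 0]
    by eventually_elim (simp add: r ennreal_of_nat_eq_real_of_nat divide_ennreal)
  ultimately have "(\<lambda>n. ?c / of_nat n) \<longlonglongrightarrow> ennreal 0"
    by (rule Lim_transform_eventually)
  from tendsto_add[OF this power.entropy_at_limit[OF traj_inert_power[OF assms]]]
  have "(\<lambda>n. ?c / of_nat n + d (T x k) (T x (k * n)) / of_nat n)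
      \<longlonglongrightarrow> entropy_at S d (\<phi> ^^ k) (T x k)"
    by (simp add: traj_power_traj[OF x])
  moreover have "d x (T x (k * n)) / of_nat n
      \<le> ?c / of_nat n + d (T x k) (T x (k * n)) / of_nat n" for n
    using divide_right_mono_ennreal[OF qm2[of x "T x k" "T x (k * n)"], of "of_nat n"] closed
    by (simp add: add_divide_distrib_ennreal)
  ultimately show ?thesis
    by (intro LIMSEQ_le[OF entropy_at_limit_multiples[OF assms]]) auto
qed

lemma entropy_power_ge: "of_nat k * entropy S d \<phi> \<le> entropy S d (\<phi> ^^ k)"
proof (cases "k = 0")
  case False
  have "of_nat k * entropy_at S d \<phi> x \<le> entropy S d (\<phi> ^^ k)" if "x \<in> inert S d \<phi>" for x
    unfolding entropy_def using that False
    by (intro order_trans[OF entropy_at_le_traj] SUP_upper traj_inert_power) auto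
  then show ?thesis
    unfolding entropy_def[of S d \<phi>] SUP_mult_left_ennreal by (intro SUP_least)
qed simp

lemma entropy_at_power_le:
  assumes "x \<in> inert S d \<phi>" "x \<in> inert S d (\<phi> ^^ k)" "k > 0"
  shows "entropy_at S d (\<phi> ^^ k) x \<le> of_nat k * entropy_at S d \<phi> x"
proof -
  interpret power: quasimetric_flow S d "\<phi> ^^ k" by (rule flow_power)
  have x: "x \<in> S" using assms by (simp add: inert_def)
  have "d x (power.T x n) / of_nat n \<le> d x (T x (k * n)) / of_nat n" for n
    using traj_power_le[OF x assms(3)] x
    by (intro divide_right_mono_ennreal dist_mono_right traj_closed power.traj_closed)
  then show ?thesis
    using LIMSEQ_le[OF power.entropy_at_limit[OF assms(2)]
        entropy_at_limit_multiples[OF assms(1,3)]]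
    by blast
qed

lemma entropy_power_le:
  assumes "inert S d (\<phi> ^^ k) \<subseteq> inert S d \<phi>"
  shows "entropy S d (\<phi> ^^ k) \<le> of_nat k * entropy S d \<phi>"
proof (cases "k = 0")
  case True
  then show ?thesis by (simp add: entropy_id flip: id_def)
next
  case False
  have "entropy_at S d (\<phi> ^^ k) x \<le> of_nat k * entropy S d \<phi>"
    if x: "x \<in> inert S d (\<phi> ^^ k)" for x
  proof -
    have "entropy_at S d (\<phi> ^^ k) x \<le> of_nat k * entropy_at S d \<phi> x"
      using assms x False by (intro entropy_at_power_le) auto
    also have "\<dots> \<le> of_nat k * entropy S d \<phi>"
      unfolding entropy_def using assms x by (intro mult_left_mono SUP_upper) auto
    finally show ?thesis .
  qed
  then show ?thesis
    unfolding entropy_def[of S d "\<phi> ^^ k"] by (rule SUP_least)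
qed

end

theorem corollary4p9:
  fixes S :: "'a set" and d :: "'a \<Rightarrow> 'a \<Rightarrow> ennreal" and \<phi> :: "'a \<Rightarrow> 'a" and k :: nat
  assumes "Lqm_flow S d \<phi>"
    and "entropy S d (\<phi> ^^ k) = 0 \<or> inert S d \<phi> = inert S d (\<phi> ^^ k)"
  shows "entropy S d (\<phi> ^^ k) = of_nat k * entropy S d \<phi>"
proof -
  interpret quasimetric_flow S d \<phi>
    using assms(1) by (simp add: Lqm_flow_def quasimetric_flow_def quasimetric_flow_axioms_def)
  from assms(2) show ?thesis
  proof
    assume "entropy S d (\<phi> ^^ k) = 0"
    then show ?thesis using entropy_power_ge[of k] by simp
  next
    assume "inert S d \<phi> = inert S d (\<phi> ^^ k)"
    then show ?thesis
      by (intro antisym entropy_power_le entropy_power_ge) simp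
  qed
qed

end
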